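(* The map from the points of the completed Okubic affine plane $\overline{\mathscr{A}_2}(\mathcal{O})$ to the points of the Okubic projective plane $\mathbb{P}^2\mathcal{O}$ given by $$(x,y)\mapsto\mathbb{R}(x,y,x*y;\,n(y),n(x),1),\qquad (x)\mapsto\mathbb{R}(0,0,x;\,n(x),1,0),\qquad (\infty)\mapsto\mathbb{R}(0,0,0;\,1,0,0)$$ for $x,y\in\mathcal{O}$ is well defined and is a bijection. The map from the lines of $\overline{\mathscr{A}_2}(\mathcal{O})$ to the lines of $\mathbb{P}^2\mathcal{O}$ given by $$[s,t]\mapsto(t*s,-t,-s;\,1,n(s),n(t))^{\perp},\qquad [c]\mapsto(-c,0,0;\,0,1,n(c))^{\perp},\qquad [\infty]\mapsto(0,0,0;\,0,0,1)^{\perp}$$ for $s,t,c\in\mathcal{O}$ is also a bijection. Moreover, a point $(x,y)$ is incident to a line $[s,t]$ if and only if the image of $(x,y)$ is incident to the image of $[s,t]$ in $\mathbb{P}^2\mathcal{O}$.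
   Context: The real Okubo algebra $\mathcal{O}$ is the 8-dimensional real vector space of $3\times 3$ complex Hermitian traceless matrices with product $x*y=\mu\, xy+\overline{\mu}\, yx-\frac13\mathrm{Tr}(xy)\,I_3$, where $\mu=\frac16(3+\mathrm{i}\sqrt3)$ and juxtaposition is the ordinary matrix product. Its norm is $n(x)=\frac16\mathrm{Tr}(x^2)$, with polar form $\langle x,y\rangle=n(x+y)-n(x)-n(y)$. Completed affine plane $\overline{\mathscr{A}_2}(\mathcal{O})$: its points are the pairs $(x,y)\in\mathcal{O}^2$, the points at infinity $(s)$ for $s\in\mathcal{O}$, and one further point $(\infty)$. Its lines are: $[s,t]=\{(x,s*x+t):x\in\mathcal{O}\}\cup\{(s)\}$ for $s,t\in\mathcal{O}$; $[c]=(\{c\}\times\mathcal{O})\cup\{(\infty)\}$ for $c\in\mathcal{O}$; and the line at infinity $[\infty]=\{(s):s\in\mathcal{O}\}\cup\{(\infty)\}$. Incidence is membership. Okubic projective plane $\mathbb{P}^2\mathcal{O}$: let $V=\mathcal{O}^3\times\mathbb{R}^3$, with elements written $(x_1,x_2,x_3;\lambda_1,\lambda_2,\lambda_3)$. Such a vector is Okubic Veronese if $$\lambda_1x_1=x_2*x_3,\quad \lambda_2x_2=x_3*x_1,\quad \lambda_3x_3=x_1*x_2,\quad n(x_1)=\lambda_2\lambda_3,\quad n(x_2)=\lambda_3\lambda_1,\quad n(x_3)=\lambda_1\lambda_2 .$$ Let $H\subset V$ be the set of Okubic Veronese vectors (it is stable under real scaling). The points of $\mathbb{P}^2\mathcal{O}$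 are the one-dimensional subspaces $\mathbb{R}w$ with $w\in H\setminus\{0\}$. On $V$ put $\beta\big((x_\nu;\lambda_\nu),(y_\nu;\eta_\nu)\big)=\sum_{\nu=1}^3(\langle x_\nu,y_\nu\rangle+\lambda_\nu\eta_\nu)$. The lines of $\mathbb{P}^2\mathcal{O}$ are the orthogonal spaces $w^{\perp}=\{z\in V:\beta(z,w)=0\}$ for $w\in H\setminus\{0\}$, and a point $\mathbb{R}v$ is incident to $w^\perp$ when $\mathbb{R}v\subseteq w^\perp$. *)

theory Defs
  imports "HOL-Analysis.Analysis"
begin

definition hermitian :: "complex^'n^'n \<Rightarrow> bool" where
  "hermitian A \<longleftrightarrow> (\<forall>i j. cnj (A $ j $ i) = A $ i $ j)"

definition okubo_mu :: complex where
  "okubo_mu = (3 + \<i> * complex_of_real (sqrt 3)) / 6"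

definition okubo_product :: "complex^3^3 \<Rightarrow> complex^3^3 \<Rightarrow> complex^3^3" where
  "okubo_product x y =
     (\<chi> i j. okubo_mu * (x ** y) $ i $ j + cnj okubo_mu * (y ** x) $ i $ j
            - (1/3) * trace (x ** y) * (mat 1 :: complex^3^3) $ i $ j)"

lemma cnj_matrix_mult:
  assumes "hermitian A" "hermitian B"
  shows "cnj ((A ** B) $ i $ j) = (B ** A) $ j $ i"
proof -
  have "cnj (A $ i $ k * B $ k $ j) = B $ j $ k * A $ k $ i" for k
    using assms by (simp add: hermitian_def)
  then show ?thesis
    by (simp add: matrix_matrix_mult_def cnj_sum)
qed

lemma hermitian_okubo_product:
  assumes "hermitian x" "hermitian y"
  shows "hermitian (okubo_product x y)"
proof -
  have "cnj (trace (x ** y)) = trace (y ** x)"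
    by (simp add: trace_def cnj_sum cnj_matrix_mult[OF assms])
  then have tr: "cnj (trace (x ** y)) = trace (x ** y)"
    using trace_mul_sym[of y x] by (rule trans)
  have "cnj (okubo_product x y $ j $ i) = okubo_product x y $ i $ j" for i j
  proof -
    have "cnj ((mat 1 :: complex^3^3) $ j $ i) = (mat 1 :: complex^3^3) $ i $ j"
      by (simp add: mat_def)
    then show ?thesis
      by (simp only: okubo_product_def vec_lambda_beta complex_cnj_add complex_cnj_diff
          complex_cnj_mult complex_cnj_cnj complex_cnj_divide complex_cnj_one complex_cnj_numeral
          tr cnj_matrix_mult[OF assms] cnj_matrix_mult[OF assms(2,1)])
        (simp only: add.commute)
  qed
  then show ?thesis
    by (simp add: hermitian_def)
qed

lemma trace_okubo_product: "trace (okubo_product x y) = 0"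
proof -
  have "trace (okubo_product x y) =
        okubo_mu * trace (x ** y) + cnj okubo_mu * trace (y ** x) - trace (x ** y)"
    by (simp add: trace_def okubo_product_def sum_3 mat_def algebra_simps)
  also have "\<dots> = (okubo_mu + cnj okubo_mu - 1) * trace (x ** y)"
    by (simp add: trace_mul_sym[of y x] algebra_simps)
  also have "okubo_mu + cnj okubo_mu - 1 = 0"
    by (simp add: okubo_mu_def complex_eq_iff)
  finally show ?thesis by simp
qed

typedef okubo = "{A :: complex^3^3. hermitian A \<and> trace A = 0}"
  morphisms okubo_matrix Okubo
  by (rule exI[of _ 0]) (simp add: hermitian_def trace_def)

setup_lifting type_definition_okubo

instantiation okubo :: real_vector
begin

lift_definition zero_okubo :: okubo is 0
  by (simp add: hermitian_def trace_def)

lift_definition plus_okubo :: "okubo \<Rightarrow> okubo \<Rightarrow> okubo" is "(+)"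
  by (auto simp: hermitian_def trace_def sum.distrib)

lift_definition minus_okubo :: "okubo \<Rightarrow> okubo \<Rightarrow> okubo" is "(-)"
  by (auto simp: hermitian_def trace_def sum_subtractf)

lift_definition uminus_okubo :: "okubo \<Rightarrow> okubo" is uminus
  by (auto simp: hermitian_def trace_def sum_negf)

lift_definition scaleR_okubo :: "real \<Rightarrow> okubo \<Rightarrow> okubo" is scaleR
  by (auto simp: hermitian_def trace_def scaleR_sum_right[symmetric])

instance
  by standard (transfer; simp add: algebra_simps)+

end

lift_definition okubo_mult :: "okubo \<Rightarrow> okubo \<Rightarrow> okubo"  (infixl "\<star>" 70)
  is okubo_product
  by (simp add: hermitian_okubo_product trace_okubo_product)

text \<open>The trace of the square of a Hermitian matrix is real, so \<open>Re\<close> only changes the type.\<close>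

definition okubo_norm :: "okubo \<Rightarrow> real" where
  "okubo_norm x = (1/6) * Re (trace (okubo_matrix x ** okubo_matrix x))"

definition okubo_polar :: "okubo \<Rightarrow> okubo \<Rightarrow> real" where
  "okubo_polar x y = okubo_norm (x + y) - okubo_norm x - okubo_norm y"

datatype affine_point =
    Finite okubo okubo  \<comment> \<open>\<open>(x, y)\<close>\<close>
  | Slope okubo         \<comment> \<open>\<open>(s)\<close>\<close>
  | Infinity            \<comment> \<open>\<open>(\<infinity>)\<close>\<close>

definition slope_line :: "okubo \<Rightarrow> okubo \<Rightarrow> affine_point set" where
  "slope_line s t = {Finite x (s \<star> x + t) | x. True} \<union> {Slope s}"

definition vertical_line :: "okubo \<Rightarrow> affine_point set" where
  "vertical_line c = {Finite c y | y. True} \<union> {Infinity}"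

definition infinity_line :: "affine_point set" where
  "infinity_line = {Slope s | s. True} \<union> {Infinity}"

definition affine_lines :: "affine_point set set" where
  "affine_lines = {slope_line s t | s t. True} \<union> {vertical_line c | c. True} \<union> {infinity_line}"

text \<open>A tuple \<open>(x\<^sub>1, x\<^sub>2, x\<^sub>3, l\<^sub>1, l\<^sub>2, l\<^sub>3)\<close> is the vector written
  \<open>(x\<^sub>1, x\<^sub>2, x\<^sub>3; l\<^sub>1, l\<^sub>2, l\<^sub>3)\<close> on paper; the real vector space structure on this type is
  the componentwise one of the library.\<close>

type_synonym okubo_vector = "okubo \<times> okubo \<times> okubo \<times> real \<times> real \<times> real"

fun okubo_veronese :: "okubo_vector \<Rightarrow> bool" where
  "okubo_veronese (x1, x2, x3, l1, l2, l3) \<longleftrightarrow>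
     l1 *\<^sub>R x1 = x2 \<star> x3 \<and> l2 *\<^sub>R x2 = x3 \<star> x1 \<and> l3 *\<^sub>R x3 = x1 \<star> x2 \<and>
     okubo_norm x1 = l2 * l3 \<and> okubo_norm x2 = l3 * l1 \<and> okubo_norm x3 = l1 * l2"

definition veronese_vectors :: "okubo_vector set" where
  "veronese_vectors = {w. okubo_veronese w}"

fun okubo_form :: "okubo_vector \<Rightarrow> okubo_vector \<Rightarrow> real" where
  "okubo_form (x1, x2, x3, l1, l2, l3) (y1, y2, y3, m1, m2, m3) =
     (okubo_polar x1 y1 + l1 * m1) + (okubo_polar x2 y2 + l2 * m2) + (okubo_polar x3 y3 + l3 * m3)"

definition orthogonal_space :: "okubo_vector \<Rightarrow> okubo_vector set" where
  "orthogonal_space w = {z. okubo_form z w = 0}"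

definition projective_points :: "okubo_vector set set" where
  "projective_points = {span {w} | w. w \<in> veronese_vectors - {0}}"

definition projective_lines :: "okubo_vector set set" where
  "projective_lines = {orthogonal_space w | w. w \<in> veronese_vectors - {0}}"

definition projective_incident :: "okubo_vector set \<Rightarrow> okubo_vector set \<Rightarrow> bool" where
  "projective_incident p l \<longleftrightarrow> p \<subseteq> l"

fun point_map :: "affine_point \<Rightarrow> okubo_vector set" where
  "point_map (Finite x y) = span {(x, y, x \<star> y, okubo_norm y, okubo_norm x, 1)}"
| "point_map (Slope x) = span {(0, 0, x, okubo_norm x, 1, 0)}"
| "point_map Infinity = span {(0, 0, 0, 1, 0, 0)}"

end

theory Submission
  imports Defs
begin

text \<open>
  The Okubo algebra is a symmetric composition algebra with positive definite norm, and this is all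
  the geometry needs. The central identity \<open>(x \<star> y) \<star> x = n(x) y = x \<star> (y \<star> x)\<close>
  (\<open>okubo_mult_sandwich\<close>) is the polarised Cayley-Hamilton theorem for traceless \<open>3 \<times> 3\<close> matrices
  in disguise. Together with the associativity of the polar form (\<open>okubo_polar_assoc\<close>), which comes
  from the cyclicity of the trace, it gives \<open>n(x \<star> y) = n(x) n(y)\<close>. The norm is positive definite because
  \<open>Tr(x\<^sup>2)\<close> is the sum of the squared absolute values of the entries of a Hermitian \<open>x\<close>.

  The sandwich identity and multiplicativity say exactly that the given vectors are Veronese.
  Conversely, normalise a nonzero Veronese vector at its last coordinate for points, and at its first
  for lines. If that coordinate \<open>\<lambda>\<close> is nonzero, scaling it to \<open>1\<close> leaves two of the \<open>x\<^sub>i\<close> free and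
  the Veronese equations determine everything else. If \<open>\<lambda> = 0\<close>, two norms vanish, hence so do
  two of the \<open>x\<^sub>i\<close>, and only the vectors of points at infinity, respectively of vertical lines and
  the line at infinity, remain. Hence the coordinates
  parametrise the projective points bijectively. They parametrise the lines as well, because
  \<open>\<beta>\<close> is positive definite, so that an orthogonal space determines its normal vector up to a factor.

  For incidence, \<open>\<beta>\<close> of the vectors attached to \<open>(x, y)\<close> and \<open>[s, t]\<close> is the expansion of
  \<open>n(s \<star> x + t - y)\<close> (\<open>okubo_form_finite_oblique\<close>); by definiteness it vanishes precisely when
  \<open>y = s \<star> x + t\<close>.
\<close>

section \<open>The Okubo algebra as a symmetric composition algebra\<close>

lemma okubo_mu_add_cnj: "okubo_mu + cnj okubo_mu = 1"
  by (simp add: okubo_mu_def complex_eq_iff)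

lemma okubo_mu_mult_cnj: "okubo_mu * cnj okubo_mu = 1 / 3"
  by (simp add: okubo_mu_def complex_eq_iff power2_eq_square[symmetric] power_divide)

lemma okubo_mu_squares: "okubo_mu * okubo_mu + cnj okubo_mu * cnj okubo_mu = 1 / 3"
proof -
  have "okubo_mu * okubo_mu + cnj okubo_mu * cnj okubo_mu =
      (okubo_mu + cnj okubo_mu) * (okubo_mu + cnj okubo_mu) - 2 * (okubo_mu * cnj okubo_mu)"
    by (simp add: algebra_simps)
  then show ?thesis by (simp only: okubo_mu_add_cnj okubo_mu_mult_cnj) simp
qed

text \<open>Cayley-Hamilton for a traceless \<open>3 \<times> 3\<close> matrix reads
  \<open>x\<^sup>3 = Tr(x\<^sup>2)/2 x + Tr(x\<^sup>3)/3\<close>; this is its derivative in the direction \<open>y\<close>. Both matrices are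
  traceless, so eliminating the last diagonal entry leaves a polynomial identity for each entry.\<close>

lemma polarised_cayley_hamilton:
  fixes x y :: "complex^3^3"
  assumes "trace x = 0" "trace y = 0"
  shows "((x ** x) ** y) $ i $ j + ((x ** y) ** x) $ i $ j + ((y ** x) ** x) $ i $ j =
    trace (x ** y) * x $ i $ j + trace (x ** x) / 2 * y $ i $ j
      + trace ((x ** x) ** y) * (mat 1 :: complex^3^3) $ i $ j"
proof -
  have x: "x $ 3 $ 3 = - x $ 1 $ 1 - x $ 2 $ 2" and y: "y $ 3 $ 3 = - y $ 1 $ 1 - y $ 2 $ 2"
    using assms by (auto simp: trace_def sum_3 algebra_simps add_eq_0_iff)
  have ne: "(1::3) \<noteq> 2" "(2::3) \<noteq> 1" "(1::3) \<noteq> 3" "(3::3) \<noteq> 1" "(2::3) \<noteq> 3" "(3::3) \<noteq> 2"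
    by simp_all
  have "\<forall>i j. 2 * (((x ** x) ** y) $ i $ j + ((x ** y) ** x) $ i $ j + ((y ** x) ** x) $ i $ j) =
    2 * (trace (x ** y) * x $ i $ j) + trace (x ** x) * y $ i $ j
      + 2 * (trace ((x ** x) ** y) * (if i = j then 1 else 0))"
    unfolding forall_3
    by (intro conjI; simp only: ne if_True if_False simp_thms;
      unfold trace_def matrix_matrix_mult_def sum_3 vec_lambda_beta x y; algebra)
  then have "2 * (((x ** x) ** y) $ i $ j + ((x ** y) ** x) $ i $ j + ((y ** x) ** x) $ i $ j) =
    2 * (trace (x ** y) * x $ i $ j) + trace (x ** x) * y $ i $ j
      + 2 * (trace ((x ** x) ** y) * (mat 1 :: complex^3^3) $ i $ j)"
    by (simp only: mat_def vec_lambda_beta)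
  then show ?thesis
    by (simp add: field_simps)
qed

lemma okubo_product_mult_left:
  "(okubo_product x y ** z) $ i $ j = okubo_mu * ((x ** y) ** z) $ i $ j
     + cnj okubo_mu * ((y ** x) ** z) $ i $ j - (1/3) * trace (x ** y) * z $ i $ j"
proof -
  let ?T = "trace (x ** y)"
  have "(okubo_product x y ** z) $ i $ j = (\<Sum>k\<in>UNIV. okubo_mu * ((x ** y) $ i $ k * z $ k $ j)
      + cnj okubo_mu * ((y ** x) $ i $ k * z $ k $ j)
      - (1/3) * ?T * ((mat 1 :: complex^3^3) $ i $ k * z $ k $ j))"
    unfolding matrix_matrix_mult_def[of "okubo_product x y"]
    by (simp add: okubo_product_def algebra_simps)
  also have "\<dots> = okubo_mu * ((x ** y) ** z) $ i $ j + cnj okubo_mu * ((y ** x) ** z) $ i $ j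
      - (1/3) * ?T * ((mat 1 :: complex^3^3) ** z) $ i $ j"
    unfolding matrix_matrix_mult_def[of _ z]
    by (simp only: vec_lambda_beta sum.distrib sum_subtractf sum_distrib_left)
  finally show ?thesis by simp
qed

lemma okubo_product_mult_right:
  "(z ** okubo_product x y) $ i $ j = okubo_mu * ((z ** x) ** y) $ i $ j
     + cnj okubo_mu * ((z ** y) ** x) $ i $ j - (1/3) * trace (x ** y) * z $ i $ j"
proof -
  let ?T = "trace (x ** y)"
  have "(z ** okubo_product x y) $ i $ j = (\<Sum>k\<in>UNIV. okubo_mu * (z $ i $ k * (x ** y) $ k $ j)
      + cnj okubo_mu * (z $ i $ k * (y ** x) $ k $ j)
      - (1/3) * ?T * (z $ i $ k * (mat 1 :: complex^3^3) $ k $ j))"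
    unfolding matrix_matrix_mult_def[of z "okubo_product x y"]
    by (simp add: okubo_product_def algebra_simps)
  also have "\<dots> = okubo_mu * (z ** (x ** y)) $ i $ j + cnj okubo_mu * (z ** (y ** x)) $ i $ j
      - (1/3) * ?T * (z ** (mat 1 :: complex^3^3)) $ i $ j"
    unfolding matrix_matrix_mult_def[of z]
    by (simp only: vec_lambda_beta sum.distrib sum_subtractf sum_distrib_left)
  finally show ?thesis by (simp add: matrix_mul_assoc)
qed

lemma trace_okubo_product_mult:
  "trace (okubo_product x y ** z) = okubo_mu * trace ((x ** y) ** z)
     + cnj okubo_mu * trace ((y ** x) ** z) - (1/3) * trace (x ** y) * trace z"
  by (simp add: trace_def[of "_ ** z"] trace_def[of z] okubo_product_mult_left
      sum.distrib sum_subtractf sum_distrib_left)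

lemma trace_mult_cycle: "trace ((A ** B) ** C) = trace ((B ** C) ** A)" for A B C :: "complex^3^3"
  using trace_mul_sym[of A "B ** C"] by (simp only: matrix_mul_assoc)

text \<open>Since \<open>\<mu> + cnj \<mu> = 1\<close> and \<open>\<mu>\<^sup>2 + (cnj \<mu>)\<^sup>2 = \<mu> cnj \<mu> = 1/3\<close>, the three words
  \<open>xxy\<close>, \<open>xyx\<close>, \<open>yxx\<close> all appear with the coefficient \<open>1/3\<close> in either double product. This symmetry is
  what makes \<open>\<mu>\<close> the right constant: their sum is the left side of the polarised Cayley-Hamilton
  identity, and the trace corrections of the product cancel all but the multiple of \<open>y\<close>.\<close>

lemma okubo_product_sandwich:
  assumes "trace x = 0" "trace y = 0"
  shows "okubo_product (okubo_product x y) x $ i $ j = trace (x ** x) / 6 * y $ i $ j"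
    and "okubo_product x (okubo_product y x) $ i $ j = trace (x ** x) / 6 * y $ i $ j"
proof -
  let ?a = okubo_mu and ?b = "cnj okubo_mu"
  let ?p = "((x ** y) ** x) $ i $ j" and ?q = "((x ** x) ** y) $ i $ j"
  let ?r = "((y ** x) ** x) $ i $ j" and ?X = "x $ i $ j" and ?I = "(mat 1 :: complex^3^3) $ i $ j"
  let ?T = "trace (x ** y)" and ?S = "trace ((x ** x) ** y)"
  have cyc: "trace ((x ** y) ** x) = ?S" "trace ((y ** x) ** x) = ?S"
    by (rule trace_mult_cycle[of x x y, symmetric], rule trace_mult_cycle[of y x x])
  have S: "?a * ?S + ?b * ?S = ?S"
    by (simp only: distrib_right[symmetric] okubo_mu_add_cnj mult_1_left)
  have tr: "trace (okubo_product x y ** x) = ?S" "trace (x ** okubo_product y x) = ?S"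
    using assms S trace_mul_sym[of x "okubo_product y x"]
    by (simp_all add: trace_okubo_product_mult cyc)
  \<comment> \<open>\<open>u\<close> and \<open>v\<close> stand for the words \<open>yxx\<close> and \<open>xxy\<close>, whose roles are exchanged in the two claims.\<close>
  have collect: "?a * (?a * ?p + ?b * u - (1/3) * ?T * ?X) + ?b * (?a * v + ?b * ?p - (1/3) * ?T * ?X)
      - (1/3) * ?S * ?I = (?p + u + v - ?T * ?X - ?S * ?I) / 3" for u v
  proof -
    have "?a * (?a * ?p + ?b * u - (1/3) * ?T * ?X) + ?b * (?a * v + ?b * ?p - (1/3) * ?T * ?X)
      = (?a * ?a + ?b * ?b) * ?p + (?a * ?b) * (u + v) - (?a + ?b) * ((1/3) * ?T * ?X)"
      by (simp only: ring_distribs right_diff_distrib left_diff_distrib ac_simps) (simp add: algebra_simps)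
    then show ?thesis
      by (simp only: okubo_mu_add_cnj okubo_mu_mult_cnj okubo_mu_squares) (simp add: field_simps)
  qed
  have ch: "(?p + ?q + ?r - ?T * ?X - ?S * ?I) / 3 = trace (x ** x) / 6 * y $ i $ j"
  proof -
    have "?p + ?q + ?r - ?T * ?X - ?S * ?I = trace (x ** x) / 2 * y $ i $ j"
      using polarised_cayley_hamilton[OF assms, of i j] by (simp add: algebra_simps)
    then show ?thesis by (simp only:) simp
  qed
  have "okubo_product (okubo_product x y) x $ i $ j =
      ?a * (okubo_product x y ** x) $ i $ j + ?b * (x ** okubo_product x y) $ i $ j
      - (1/3) * ?S * ?I"
    by (subst okubo_product_def) (simp add: tr)
  also have "\<dots> = (?p + ?q + ?r - ?T * ?X - ?S * ?I) / 3"
    unfolding okubo_product_mult_left okubo_product_mult_right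
    by (subst collect) (simp add: algebra_simps)
  finally show "okubo_product (okubo_product x y) x $ i $ j = trace (x ** x) / 6 * y $ i $ j"
    by (simp only: ch)
  have "okubo_product x (okubo_product y x) $ i $ j =
      ?a * (x ** okubo_product y x) $ i $ j + ?b * (okubo_product y x ** x) $ i $ j
      - (1/3) * ?S * ?I"
    by (subst okubo_product_def) (simp add: tr)
  also have "\<dots> = ?a * (?a * ?p + ?b * ?q - (1/3) * ?T * ?X)
      + ?b * (?a * ?r + ?b * ?p - (1/3) * ?T * ?X) - (1/3) * ?S * ?I"
    unfolding okubo_product_mult_left okubo_product_mult_right
    by (simp add: trace_mul_sym[of y x] algebra_simps)
  also have "\<dots> = (?p + ?q + ?r - ?T * ?X - ?S * ?I) / 3"
    by (subst collect) (simp add: algebra_simps)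
  finally show "okubo_product x (okubo_product y x) $ i $ j = trace (x ** x) / 6 * y $ i $ j"
    by (simp only: ch)
qed

lemma hermitian_okubo_matrix: "hermitian (okubo_matrix x)"
  and trace_okubo_matrix [simp]: "trace (okubo_matrix x) = 0"
  using okubo_matrix[of x] by auto

lemma trace_hermitian_square:
  assumes "hermitian A"
  shows "trace (A ** A) = of_real (\<Sum>i\<in>UNIV. \<Sum>j\<in>UNIV. (cmod (A $ i $ j))\<^sup>2)"
proof -
  have "A $ i $ j * A $ j $ i = of_real ((cmod (A $ i $ j))\<^sup>2)" for i j
  proof -
    have "A $ j $ i = cnj (A $ i $ j)"
      using assms by (simp add: hermitian_def)
    then show ?thesis
      by (simp only: complex_norm_square)
  qed
  then show ?thesis
    by (simp add: trace_def matrix_matrix_mult_def)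
qed

text \<open>The trace here is real, so the \<open>Re\<close> in the norm can be dropped; this lets the complex matrix
  identities descend to the real algebra.\<close>

lemma okubo_norm_trace: "trace (okubo_matrix x ** okubo_matrix x) / 6 = of_real (okubo_norm x)"
  by (simp add: okubo_norm_def trace_hermitian_square[OF hermitian_okubo_matrix])

lemma okubo_norm_eq_0_iff [simp]: "okubo_norm x = 0 \<longleftrightarrow> x = 0"
  and okubo_norm_nonneg [simp]: "0 \<le> okubo_norm x"
proof -
  have n: "okubo_norm x = (1/6) * (\<Sum>i\<in>UNIV. \<Sum>j\<in>UNIV. (cmod (okubo_matrix x $ i $ j))\<^sup>2)"
    by (simp add: okubo_norm_def trace_hermitian_square[OF hermitian_okubo_matrix])
  have "okubo_norm x = 0 \<longleftrightarrow> okubo_matrix x = 0"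
    unfolding n by (simp add: sum_nonneg_eq_0_iff sum_nonneg vec_eq_iff)
  then show "okubo_norm x = 0 \<longleftrightarrow> x = 0"
    using okubo_matrix_inject[of x 0] by (simp add: zero_okubo.rep_eq)
  show "0 \<le> okubo_norm x"
    unfolding n by (simp add: sum_nonneg)
qed

lemma matrix_add_rdistrib: "(A + B) ** C = A ** C + B ** C" for A B C :: "complex^3^3"
  by (simp add: vec_eq_iff matrix_matrix_mult_def distrib_right sum.distrib)

lemma matrix_scaleR_mult: "(r *\<^sub>R A) ** B = r *\<^sub>R (A ** B)" "A ** (r *\<^sub>R B) = r *\<^sub>R (A ** B)"
  for A B :: "complex^3^3"
  by (simp_all add: vec_eq_iff matrix_matrix_mult_def scaleR_sum_right)

lemma trace_scaleR: "trace (r *\<^sub>R A) = r *\<^sub>R trace A" for A :: "complex^3^3"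
  by (simp add: trace_def scaleR_sum_right)

lemma okubo_mult_scaleR [simp]:
  "(r *\<^sub>R x) \<star> y = r *\<^sub>R (x \<star> y)" "x \<star> (r *\<^sub>R y) = r *\<^sub>R (x \<star> y)"
  by (transfer; simp add: vec_eq_iff okubo_product_def matrix_scaleR_mult trace_scaleR
      scaleR_conv_of_real[where 'a = complex] algebra_simps)+

lemma okubo_mult_0 [simp]: "0 \<star> y = 0" "x \<star> 0 = 0"
  using okubo_mult_scaleR(1)[of 0 0 y] okubo_mult_scaleR(2)[of x 0 0] by simp_all

lemma okubo_mult_minus [simp]: "(- x) \<star> y = - (x \<star> y)" "x \<star> (- y) = - (x \<star> y)"
  using okubo_mult_scaleR(1)[of "-1" x y] okubo_mult_scaleR(2)[of x "-1" y] by simp_all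

lemma okubo_mult_sandwich:
  "(x \<star> y) \<star> x = okubo_norm x *\<^sub>R y" "x \<star> (y \<star> x) = okubo_norm x *\<^sub>R y"
  unfolding okubo_matrix_inject[symmetric] vec_eq_iff okubo_mult.rep_eq scaleR_okubo.rep_eq
  by (simp_all add: okubo_product_sandwich okubo_norm_trace scaleR_conv_of_real[where 'a = complex])

lemma okubo_polar_trace: "okubo_polar x y = Re (trace (okubo_matrix x ** okubo_matrix y)) / 3"
proof -
  have "trace ((A + B) ** (A + B)) = trace (A ** A) + trace (B ** B) + 2 * trace (A ** B)"
    for A B :: "complex^3^3"
    using trace_mul_sym[of A B]
    by (simp add: matrix_add_ldistrib matrix_add_rdistrib trace_add)
  then show ?thesis
    by (simp add: okubo_polar_def okubo_norm_def plus_okubo.rep_eq add_divide_distrib)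
qed

lemma okubo_polar_commute: "okubo_polar x y = okubo_polar y x"
  by (simp add: okubo_polar_def add.commute)

lemma okubo_polar_add [simp]: "okubo_polar (x + y) z = okubo_polar x z + okubo_polar y z"
  by (simp add: okubo_polar_trace plus_okubo.rep_eq matrix_add_rdistrib trace_add add_divide_distrib)

lemma okubo_polar_scaleR [simp]: "okubo_polar (r *\<^sub>R x) y = r * okubo_polar x y"
  "okubo_polar x (r *\<^sub>R y) = r * okubo_polar x y"
  by (simp_all add: okubo_polar_trace scaleR_okubo.rep_eq matrix_scaleR_mult trace_scaleR)

lemma okubo_polar_minus [simp]: "okubo_polar (- x) y = - okubo_polar x y"
  "okubo_polar x (- y) = - okubo_polar x y"
  using okubo_polar_scaleR(1)[of "-1" x y] okubo_polar_scaleR(2)[of x "-1" y] by simp_all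

lemma okubo_polar_0 [simp]: "okubo_polar 0 y = 0" "okubo_polar x 0 = 0"
  using okubo_polar_scaleR(1)[of 0 0 y] okubo_polar_scaleR(2)[of x 0 0] by simp_all

lemma okubo_polar_self: "okubo_polar x x = 2 * okubo_norm x"
  by (simp add: okubo_polar_trace okubo_norm_def)

lemma okubo_norm_scaleR: "okubo_norm (r *\<^sub>R x) = r\<^sup>2 * okubo_norm x"
  using okubo_polar_self[of "r *\<^sub>R x"] okubo_polar_self[of x] by (simp add: power2_eq_square)

lemma okubo_norm_minus [simp]: "okubo_norm (- x) = okubo_norm x"
  using okubo_polar_self[of "- x"] okubo_polar_self[of x] by simp

lemma okubo_norm_add: "okubo_norm (x + y) = okubo_norm x + okubo_norm y + okubo_polar x y"
  by (simp add: okubo_polar_def)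

text \<open>The correction term of the product is a multiple of the identity, which a traceless factor does
  not see; what is left is a combination of traces of words of length three, and these are cyclic.\<close>

lemma okubo_polar_assoc: "okubo_polar (x \<star> y) z = okubo_polar x (y \<star> z)"
proof -
  let ?x = "okubo_matrix x" and ?y = "okubo_matrix y" and ?z = "okubo_matrix z"
  have "trace (okubo_product ?x ?y ** ?z) = trace (okubo_product ?y ?z ** ?x)"
    by (simp add: trace_okubo_product_mult trace_mult_cycle[of ?x ?y ?z] trace_mult_cycle[of ?z ?y ?x])
  also have "\<dots> = trace (?x ** okubo_product ?y ?z)"
    by (rule trace_mul_sym)
  finally show ?thesis
    by (simp add: okubo_polar_trace okubo_mult.rep_eq)
qed

text \<open>Move the first factor across the polar form in \<open>2 n(x \<star> y) = \<langle>x \<star> y, x \<star> y\<rangle>\<close> and contract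
  with the sandwich identity.\<close>

lemma okubo_norm_mult: "okubo_norm (x \<star> y) = okubo_norm x * okubo_norm y"
proof -
  have "2 * okubo_norm (x \<star> y) = okubo_polar x (y \<star> (x \<star> y))"
    by (simp only: okubo_polar_self[symmetric] okubo_polar_assoc)
  then show ?thesis
    by (simp add: okubo_mult_sandwich okubo_polar_self)
qed

section \<open>The form on the Veronese space\<close>

lemma okubo_form_commute: "okubo_form v w = okubo_form w v"
  by (cases v; cases w) (simp add: okubo_polar_commute mult.commute)

lemma okubo_form_add: "okubo_form (u + v) w = okubo_form u w + okubo_form v w"
  by (cases u; cases v; cases w) (simp add: algebra_simps)

lemma okubo_form_scaleR: "okubo_form (r *\<^sub>R v) w = r * okubo_form v w"
  by (cases v; cases w) (simp add: algebra_simps)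

lemma okubo_form_eq_0: "okubo_form v v = 0 \<Longrightarrow> v = 0"
proof (cases v)
  case (fields x1 x2 x3 l1 l2 l3)
  assume "okubo_form v v = 0"
  then have "2 * okubo_norm x1 + 2 * okubo_norm x2 + 2 * okubo_norm x3 + l1\<^sup>2 + l2\<^sup>2 + l3\<^sup>2 = 0"
    by (simp add: fields okubo_polar_self power2_eq_square)
  then have "okubo_norm x1 = 0 \<and> okubo_norm x2 = 0 \<and> okubo_norm x3 = 0 \<and> l1\<^sup>2 = 0 \<and> l2\<^sup>2 = 0 \<and> l3\<^sup>2 = 0"
    using okubo_norm_nonneg[of x1] okubo_norm_nonneg[of x2] okubo_norm_nonneg[of x3]
      zero_le_power2[of l1] zero_le_power2[of l2] zero_le_power2[of l3] by linarith
  then show "v = 0" by (simp add: fields zero_prod_def)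
qed

text \<open>The component of \<open>v\<close> orthogonal to \<open>w\<close> lies in \<open>w\<^sup>\<perp> = v\<^sup>\<perp>\<close>, so it is orthogonal to
  itself and vanishes by definiteness.\<close>

lemma orthogonal_space_eqD:
  assumes "orthogonal_space v = orthogonal_space w" "w \<noteq> 0"
  shows "\<exists>k. v = k *\<^sub>R w"
proof -
  define k where "k = okubo_form v w / okubo_form w w"
  define z where "z = v + (- k) *\<^sub>R w"
  have "okubo_form w w \<noteq> 0"
    using okubo_form_eq_0 assms(2) by blast
  then have zw: "okubo_form z w = 0"
    unfolding z_def okubo_form_add okubo_form_scaleR by (simp add: k_def)
  then have zv: "okubo_form z v = 0"
    using assms(1) by (auto simp: orthogonal_space_def)
  have "okubo_form z z = okubo_form v z + (- k) * okubo_form w z"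
    by (subst (1) z_def) (simp only: okubo_form_add okubo_form_scaleR)
  also have "\<dots> = 0"
    using zw zv by (simp add: okubo_form_commute)
  finally have "z = 0"
    by (rule okubo_form_eq_0)
  then show ?thesis
    by (auto simp: z_def intro!: exI[of _ k])
qed

lemma orthogonal_space_scaleR:
  assumes "k \<noteq> 0"
  shows "orthogonal_space (k *\<^sub>R w) = orthogonal_space w"
  using assms by (auto simp: orthogonal_space_def okubo_form_commute[of _ "k *\<^sub>R w"]
      okubo_form_commute[of _ w] okubo_form_scaleR)

lemma span_scaleR:
  assumes "k \<noteq> 0"
  shows "span {k *\<^sub>R w} = span {w :: 'a :: real_vector}"
proof -
  have "w \<in> span {k *\<^sub>R w}"
    using assms span_scale[OF span_base[of "k *\<^sub>R w" "{k *\<^sub>R w}"], of "inverse k"] by simp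
  then show ?thesis
    by (simp add: span_eq span_scale span_base)
qed

lemma span_subset_orthogonal_space:
  "span {v} \<subseteq> orthogonal_space w \<longleftrightarrow> okubo_form v w = 0"
proof
  show "okubo_form v w = 0" if "span {v} \<subseteq> orthogonal_space w"
    using that span_base[of v "{v}"] by (auto simp: orthogonal_space_def)
qed (auto simp: span_singleton orthogonal_space_def okubo_form_scaleR)

section \<open>Charts for points and lines\<close>

fun point_vector :: "affine_point \<Rightarrow> okubo_vector" where
  "point_vector (Finite x y) = (x, y, x \<star> y, okubo_norm y, okubo_norm x, 1)"
| "point_vector (Slope x) = (0, 0, x, okubo_norm x, 1, 0)"
| "point_vector Infinity = (0, 0, 0, 1, 0, 0)"

lemma point_map_eq: "point_map p = span {point_vector p}"
  by (cases p) auto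

text \<open>The line map has to be a function of the set of points on a line. Separating the coordinates from
  that set turns the map into the composition of the inverse of one bijection with another one, so it
  is well defined as soon as the coordinates can be read off from the set.\<close>

datatype line_coordinates = Oblique okubo okubo | Vertical okubo | AtInfinity

fun affine_line :: "line_coordinates \<Rightarrow> affine_point set" where
  "affine_line (Oblique s t) = slope_line s t"
| "affine_line (Vertical c) = vertical_line c"
| "affine_line AtInfinity = infinity_line"

fun line_vector :: "line_coordinates \<Rightarrow> okubo_vector" where
  "line_vector (Oblique s t) = (t \<star> s, - t, - s, 1, okubo_norm s, okubo_norm t)"
| "line_vector (Vertical c) = (- c, 0, 0, 0, 1, okubo_norm c)"
| "line_vector AtInfinity = (0, 0, 0, 0, 0, 1)"

lemma point_vector_veronese: "point_vector p \<in> veronese_vectors - {0}"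
  by (cases p) (auto simp: veronese_vectors_def zero_prod_def okubo_mult_sandwich okubo_norm_mult)

lemma line_vector_veronese: "line_vector l \<in> veronese_vectors - {0}"
  by (cases l) (auto simp: veronese_vectors_def zero_prod_def okubo_mult_sandwich okubo_norm_mult)

lemma point_vector_proportional:
  assumes "point_vector p = k *\<^sub>R point_vector q"
  shows "p = q"
  using assms by (cases p; cases q) auto

lemma line_vector_proportional:
  assumes "line_vector l = k *\<^sub>R line_vector m"
  shows "l = m"
  using assms by (cases l; cases m) auto

text \<open>The three cases are the affine chart, the line at infinity without its special point, and that
  point. Outside the affine chart \<open>\<lambda>\<^sub>3 = 0\<close> forces \<open>n(x\<^sub>1) = n(x\<^sub>2) = 0\<close>, hence \<open>x\<^sub>1 = x\<^sub>2 = 0\<close>.\<close>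

lemma veronese_point_vector:
  assumes "w \<in> veronese_vectors - {0}"
  obtains k p where "k \<noteq> 0" "w = k *\<^sub>R point_vector p"
proof (cases w)
  case (fields x1 x2 x3 l1 l2 l3)
  then have v: "l1 *\<^sub>R x1 = x2 \<star> x3" "l2 *\<^sub>R x2 = x3 \<star> x1" "l3 *\<^sub>R x3 = x1 \<star> x2"
      "okubo_norm x1 = l2 * l3" "okubo_norm x2 = l3 * l1" "okubo_norm x3 = l1 * l2"
    and "w \<noteq> 0"
    using assms by (auto simp: veronese_vectors_def)
  consider "l3 \<noteq> 0" | "l3 = 0" "l2 \<noteq> 0" | "l3 = 0" "l2 = 0" by blast
  then show thesis
  proof cases
    case 1
    have "w = l3 *\<^sub>R point_vector (Finite (inverse l3 *\<^sub>R x1) (inverse l3 *\<^sub>R x2))"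
      using 1 v(3)[symmetric] v(4,5) by (simp add: fields okubo_norm_scaleR power2_eq_square)
    with 1 that show thesis by blast
  next
    case 2
    have "w = l2 *\<^sub>R point_vector (Slope (inverse l2 *\<^sub>R x3))"
      using 2 v by (simp add: fields okubo_norm_scaleR power2_eq_square)
    with 2 that show thesis by blast
  next
    case 3
    with v have "w = l1 *\<^sub>R point_vector Infinity"
      by (simp add: fields)
    with \<open>w \<noteq> 0\<close> that show thesis by (metis scaleR_zero_left)
  qed
qed

text \<open>Dually, the chart is \<open>\<lambda>\<^sub>1 \<noteq> 0\<close>, and \<open>\<lambda>\<^sub>1 = 0\<close> forces \<open>x\<^sub>2 = x\<^sub>3 = 0\<close>. The vertical
  lines are normalised at \<open>\<lambda>\<^sub>2\<close>, as are the slopes among the points.\<close>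

lemma veronese_line_vector:
  assumes "w \<in> veronese_vectors - {0}"
  obtains k l where "k \<noteq> 0" "w = k *\<^sub>R line_vector l"
proof (cases w)
  case (fields x1 x2 x3 l1 l2 l3)
  then have v: "l1 *\<^sub>R x1 = x2 \<star> x3" "l2 *\<^sub>R x2 = x3 \<star> x1" "l3 *\<^sub>R x3 = x1 \<star> x2"
      "okubo_norm x1 = l2 * l3" "okubo_norm x2 = l3 * l1" "okubo_norm x3 = l1 * l2"
    and "w \<noteq> 0"
    using assms by (auto simp: veronese_vectors_def)
  consider "l1 \<noteq> 0" | "l1 = 0" "l2 \<noteq> 0" | "l1 = 0" "l2 = 0" by blast
  then show thesis
  proof cases
    case 1
    have "w = l1 *\<^sub>R line_vector (Oblique (- (inverse l1 *\<^sub>R x3)) (- (inverse l1 *\<^sub>R x2)))"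
      using 1 v(1)[symmetric] v(5,6) by (simp add: fields okubo_norm_scaleR power2_eq_square)
    with 1 that show thesis by blast
  next
    case 2
    have "w = l2 *\<^sub>R line_vector (Vertical (- (inverse l2 *\<^sub>R x1)))"
      using 2 v by (simp add: fields okubo_norm_scaleR power2_eq_square)
    with 2 that show thesis by blast
  next
    case 3
    with v have "w = l3 *\<^sub>R line_vector AtInfinity"
      by (simp add: fields)
    with \<open>w \<noteq> 0\<close> that show thesis by (metis scaleR_zero_left)
  qed
qed

lemma bij_betw_point_map: "bij_betw point_map UNIV projective_points"
proof (rule bij_betw_imageI)
  show "inj point_map"
  proof (rule injI)
    fix p q
    assume "point_map p = point_map q"
    then have "point_vector p \<in> span {point_vector q}"
      unfolding point_map_eq by (metis insertI1 span_base)
    then show "p = q"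
      by (auto simp: span_singleton intro: point_vector_proportional)
  qed
  show "range point_map = projective_points"
  proof
    show "range point_map \<subseteq> projective_points"
      unfolding projective_points_def point_map_eq using point_vector_veronese by blast
    show "projective_points \<subseteq> range point_map"
    proof
      fix P
      assume "P \<in> projective_points"
      then obtain w where "w \<in> veronese_vectors - {0}" and P: "P = span {w}"
        by (auto simp: projective_points_def)
      then obtain k p where "k \<noteq> 0" "w = k *\<^sub>R point_vector p"
        using veronese_point_vector by metis
      then show "P \<in> range point_map"
        by (simp add: P span_scaleR point_map_eq)
    qed
  qed
qed

lemma bij_betw_line_vector: "bij_betw (orthogonal_space \<circ> line_vector) UNIV projective_lines"
proof (rule bij_betw_imageI)
  show "inj (orthogonal_space \<circ> line_vector)"
    using orthogonal_space_eqD line_vector_veronese line_vector_proportional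
    by (intro injI) (metis DiffE comp_apply insertI1)
  show "range (orthogonal_space \<circ> line_vector) = projective_lines"
  proof
    show "range (orthogonal_space \<circ> line_vector) \<subseteq> projective_lines"
      unfolding projective_lines_def comp_apply using line_vector_veronese by blast
    show "projective_lines \<subseteq> range (orthogonal_space \<circ> line_vector)"
    proof
      fix L
      assume "L \<in> projective_lines"
      then obtain w where "w \<in> veronese_vectors - {0}" and L: "L = orthogonal_space w"
        by (auto simp: projective_lines_def)
      then obtain k l where "k \<noteq> 0" "w = k *\<^sub>R line_vector l"
        using veronese_line_vector by metis
      then show "L \<in> range (orthogonal_space \<circ> line_vector)"
        by (simp add: L orthogonal_space_scaleR)
    qed
  qed
qed

text \<open>The points at infinity tell the three kinds of lines apart. The slope of an oblique line is its
  point at infinity, and its intercept is the ordinate over \<open>0\<close> because \<open>s \<star> 0 = 0\<close>.\<close>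

lemma bij_betw_affine_line: "bij_betw affine_line UNIV affine_lines"
proof (rule bij_betw_imageI)
  have mem: "Finite x y \<in> affine_line (Oblique s t) \<longleftrightarrow> y = s \<star> x + t"
    "Slope a \<in> affine_line (Oblique s t) \<longleftrightarrow> a = s" "Infinity \<notin> affine_line (Oblique s t)"
    "Finite x y \<in> affine_line (Vertical c) \<longleftrightarrow> x = c"
    "Slope a \<notin> affine_line (Vertical c)" "Infinity \<in> affine_line (Vertical c)"
    "Finite x y \<notin> affine_line AtInfinity" "Slope a \<in> affine_line AtInfinity"
    "Infinity \<in> affine_line AtInfinity"
    for x y s t a c
    by (auto simp: slope_line_def vertical_line_def infinity_line_def)
  show "inj affine_line"
  proof (rule injI)
    fix l m
    assume "affine_line l = affine_line m"
    then have eq: "P \<in> affine_line l \<longleftrightarrow> P \<in> affine_line m" for P by simp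
    show "l = m"
    proof (cases l)
      case (Oblique s t)
      then show ?thesis
        using eq[of Infinity] eq[of "Slope s"] eq[of "Finite 0 t"]
        by (cases m) (simp_all del: affine_line.simps add: mem)
    next
      case (Vertical c)
      then show ?thesis
        using eq[of Infinity] eq[of "Slope 0"] eq[of "Finite c 0"]
        by (cases m) (simp_all del: affine_line.simps add: mem)
    next
      case AtInfinity
      then show ?thesis
        using eq[of Infinity] eq[of "Slope 0"]
        by (cases m) (simp_all del: affine_line.simps add: mem)
    qed
  qed
  show "range affine_line = affine_lines"
  proof
    show "range affine_line \<subseteq> affine_lines"
    proof
      fix L assume "L \<in> range affine_line"
      then obtain l where "L = affine_line l" by blast
      then show "L \<in> affine_lines" by (cases l) (auto simp: affine_lines_def)
    qed
    show "affine_lines \<subseteq> range affine_line"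
      unfolding affine_lines_def
      by (auto intro: range_eqI[of _ affine_line "Oblique _ _"] range_eqI[of _ affine_line "Vertical _"]
          range_eqI[of _ affine_line AtInfinity])
  qed
qed

text \<open>The algebraic content of incidence. The minus signs in the line coordinates are those of
  \<open>s \<star> x + t - y\<close>: the cross terms of its norm are moved into the form of \<open>\<beta>\<close> by the associativity
  of the polar form, \<open>\<langle>s \<star> x, t\<rangle> = \<langle>x, t \<star> s\<rangle>\<close> and \<open>\<langle>s \<star> x, y\<rangle> = \<langle>x \<star> y, s\<rangle>\<close>.\<close>

lemma okubo_form_finite_oblique:
  "okubo_form (point_vector (Finite x y)) (line_vector (Oblique s t)) = okubo_norm (s \<star> x + t - y)"
proof -
  have "okubo_norm (s \<star> x + t - y) = okubo_norm s * okubo_norm x + okubo_norm t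
      + okubo_polar (s \<star> x) t + okubo_norm y - okubo_polar (s \<star> x) y - okubo_polar t y"
    using okubo_norm_add[of "s \<star> x + t" "- y"] by (simp add: okubo_norm_add okubo_norm_mult)
  moreover have "okubo_polar (s \<star> x) t = okubo_polar x (t \<star> s)"
    by (metis okubo_polar_assoc okubo_polar_commute)
  moreover have "okubo_polar (s \<star> x) y = okubo_polar (x \<star> y) s"
    by (metis okubo_polar_assoc okubo_polar_commute)
  ultimately show ?thesis
    by (simp add: okubo_polar_commute[of t y] mult.commute)
qed

theorem mainTheorem3:
  shows "bij_betw point_map (UNIV :: affine_point set) projective_points \<and>
    (\<exists>line_map :: affine_point set \<Rightarrow> okubo_vector set.
       (\<forall>s t. line_map (slope_line s t) =
          orthogonal_space (t \<star> s, - t, - s, 1, okubo_norm s, okubo_norm t)) \<and>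
       (\<forall>c. line_map (vertical_line c) =
          orthogonal_space (- c, 0, 0, 0, 1, okubo_norm c)) \<and>
       line_map infinity_line = orthogonal_space (0, 0, 0, 0, 0, 1) \<and>
       bij_betw line_map affine_lines projective_lines \<and>
       (\<forall>x y s t. Finite x y \<in> slope_line s t \<longleftrightarrow>
          projective_incident (point_map (Finite x y)) (line_map (slope_line s t))))"
proof -
  define line_map where "line_map = orthogonal_space \<circ> line_vector \<circ> inv affine_line"
  have line_map: "line_map (affine_line l) = orthogonal_space (line_vector l)" for l
    using bij_betw_imp_inj_on[OF bij_betw_affine_line] by (simp add: line_map_def)
  have "bij_betw line_map affine_lines projective_lines"
    unfolding line_map_def
    by (rule bij_betw_trans[OF bij_betw_inv_into[OF bij_betw_affine_line] bij_betw_line_vector])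
  moreover have "Finite x y \<in> slope_line s t \<longleftrightarrow>
      projective_incident (point_map (Finite x y)) (line_map (slope_line s t))" for x y s t
  proof -
    have "Finite x y \<in> slope_line s t \<longleftrightarrow> s \<star> x + t - y = 0"
      by (auto simp: slope_line_def)
    also have "\<dots> \<longleftrightarrow> okubo_form (point_vector (Finite x y)) (line_vector (Oblique s t)) = 0"
      by (simp only: okubo_form_finite_oblique okubo_norm_eq_0_iff)
    also have "\<dots> \<longleftrightarrow> projective_incident (point_map (Finite x y)) (line_map (affine_line (Oblique s t)))"
      by (simp only: projective_incident_def point_map_eq line_map span_subset_orthogonal_space)
    finally show ?thesis by simp
  qed
  ultimately show ?thesis
    using bij_betw_point_map line_map[of "Oblique _ _"] line_map[of "Vertical _"] line_map[of AtInfinity]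
    by (intro conjI exI[of _ line_map] allI) simp_all
qed

end
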